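(* Every planar $3$-tree is an $\{\llcorner\}$-graph.
   Context: All graphs are finite and simple. A $3$-tree is an edge-maximal graph of treewidth $3$; equivalently, a graph that can be built starting from the complete graph $K_4$ by repeatedly adding a new vertex whose neighborhood in the graph constructed so far is a triangle (a clique on $3$ vertices). A planar $3$-tree is a $3$-tree that is planar. An axis-aligned L-shape is the union of a horizontal and a vertical segment in the plane whose intersection is an endpoint of both. An L-shape of rotation $\llcorner$ is one in which the common endpoint is the lower endpoint of the vertical segment and the left endpoint of the horizontal segment. A graph $G$ is an $\{\llcorner\}$-graph if one can assign to each vertex of $G$ an L-shape of rotation $\llcorner$ in the plane such that two distinct vertices are adjacent in $G$ if and only if their L-shapes intersect. *)

theory Defs
  imports "HOL-Analysis.Analysis"
begin

text \<open>Finite simple graphs are given by a vertex set V and a symmetric,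
irreflexive edge predicate E (with edges only between vertices of V).\<close>

inductive three_tree :: "'a set \<Rightarrow> ('a \<Rightarrow> 'a \<Rightarrow> bool) \<Rightarrow> bool" where
  K4: "card V = 4 \<Longrightarrow>
       three_tree V (\<lambda>u v. u \<in> V \<and> v \<in> V \<and> u \<noteq> v)"
| add: "three_tree V E \<Longrightarrow> n \<notin> V \<Longrightarrow> a \<in> V \<Longrightarrow> b \<in> V \<Longrightarrow> c \<in> V \<Longrightarrow>
        E a b \<Longrightarrow> E b c \<Longrightarrow> E a c \<Longrightarrow>
        three_tree (insert n V)
          (\<lambda>u v. E u v \<or> (u = n \<and> v \<in> {a, b, c}) \<or> (v = n \<and> u \<in> {a, b, c}))"

definition planar_graph :: "'a set \<Rightarrow> ('a \<Rightarrow> 'a \<Rightarrow> bool) \<Rightarrow> bool" where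
  "planar_graph V E \<longleftrightarrow>
    (\<exists>(pos :: 'a \<Rightarrow> real \<times> real) (crv :: 'a set \<Rightarrow> real \<Rightarrow> real \<times> real).
       inj_on pos V \<and>
       (\<forall>u\<in>V. \<forall>v\<in>V. E u v \<longrightarrow>
          arc (crv {u, v}) \<and>
          {pathstart (crv {u, v}), pathfinish (crv {u, v})} = {pos u, pos v} \<and>
          (\<forall>w\<in>V. w \<notin> {u, v} \<longrightarrow> pos w \<notin> path_image (crv {u, v}))) \<and>
       (\<forall>u\<in>V. \<forall>v\<in>V. \<forall>u'\<in>V. \<forall>v'\<in>V.
          E u v \<longrightarrow> E u' v' \<longrightarrow> {u, v} \<noteq> {u', v'} \<longrightarrow>
          path_image (crv {u, v}) \<inter> path_image (crv {u', v'})
            \<subseteq> pos ` ({u, v} \<inter> {u', v'})))"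

definition L_shape :: "real \<Rightarrow> real \<Rightarrow> real \<Rightarrow> real \<Rightarrow> (real \<times> real) set" where
  "L_shape x y h w = closed_segment (x, y) (x, y + h) \<union> closed_segment (x, y) (x + w, y)"

definition L_graph :: "'a set \<Rightarrow> ('a \<Rightarrow> 'a \<Rightarrow> bool) \<Rightarrow> bool" where
  "L_graph V E \<longleftrightarrow>
    (\<exists>x y h w :: 'a \<Rightarrow> real.
       (\<forall>v\<in>V. h v > 0 \<and> w v > 0) \<and>
       (\<forall>u\<in>V. \<forall>v\<in>V. u \<noteq> v \<longrightarrow>
          (E u v \<longleftrightarrow> L_shape (x u) (y u) (h u) (w u) \<inter> L_shape (x v) (y v) (h v) (w v) \<noteq> {})))"

end

theory Submission
  imports Defs
begin

text \<open>
  In a planar graph no three vertices have three common neighbours, since \<open>K\<^sub>3\<^sub>,\<^sub>3\<close> is not planar.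
  Hence, when a planar 3-tree is built up from a triangle, every triangle is stacked at most once, the
  initial one at most twice (once per side). So it suffices to draw the L-shapes such that every
  triangle that can still be stacked owns a private region, disjoint from the other private regions
  and from the other L-shapes, in which its three L-shapes appear in a fixed pattern; a new L-shape
  is then drawn inside the region, which is cut into three private regions for the new triangles.
  For an inner triangle the pattern is a comb or its reflection in the diagonal, and for the outer one
  it is an upper half-plane met by three vertical segments.
\<close>

section \<open>Nonplanarity of the complete bipartite graph on three and three vertices\<close>

text \<open>A 3-tree comes without an embedding, and the L-shapes are built without looking at the
  planar drawing: planarity enters only as a bound on the common neighbours of a triangle. A
  triangle created by stacking is born with a common neighbour, the remaining corner of the stacked
  triangle, so stacking it once gives it two and stacking it again would give three. The initial
  triangle is born with none, hence its two sides. For K(3,3), joining two vertices of one class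
  through the three vertices of the other gives three arcs with common ends. The star around the
  remaining vertex would be a connected set off these arcs that touches all three, whereas each
  complementary domain is bounded by only two of them. The arms of a new shape can only point up and
  right, so a region must be entered from its lower left. Reflection in the diagonal exchanges these
  two directions, which is why it is the symmetry that relates the two kinds of inner
  region.\<close>

definition theta :: "(real \<Rightarrow> complex) \<Rightarrow> (real \<Rightarrow> complex) \<Rightarrow> (real \<Rightarrow> complex) \<Rightarrow> complex \<Rightarrow> complex \<Rightarrow> bool" where
  "theta c1 c2 c3 p q \<longleftrightarrow>
     (\<forall>c\<in>{c1, c2, c3}. arc c \<and> pathstart c = p \<and> pathfinish c = q) \<and>
     path_image c1 \<inter> path_image c2 = {p, q} \<and>
     path_image c1 \<inter> path_image c3 = {p, q} \<and>
     path_image c2 \<inter> path_image c3 = {p, q}"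

lemma theta_swap12: "theta c1 c2 c3 p q \<Longrightarrow> theta c2 c1 c3 p q"
  and theta_swap23: "theta c1 c2 c3 p q \<Longrightarrow> theta c1 c3 c2 p q"
  by (auto simp: theta_def Int_commute)

text \<open>Jordan curve theorem for the closed curve \<open>c1 +++ reversepath c2\<close>. The
  closure formula later decides which arcs a set on one side can approach.\<close>

lemma theta_inside:
  assumes "theta c1 c2 c3 p q"
  defines "K \<equiv> path_image c1 \<union> path_image c2"
  shows "inside K \<noteq> {}" "open (inside K)" "connected (inside K)" "connected (outside K)"
    "closure (inside K) = inside K \<union> K"
proof -
  have th: "arc c1" "arc c2" "pathstart c1 = p" "pathfinish c1 = q" "pathstart c2 = p" "pathfinish c2 = q"
    "path_image c1 \<inter> path_image c2 = {p, q}"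
    using assms(1) by (auto simp: theta_def)
  have "simple_path (c1 +++ reversepath c2)"
    using th by (intro simple_path_join_loop) (auto simp: arc_reversepath)
  moreover have "pathfinish (c1 +++ reversepath c2) = pathstart (c1 +++ reversepath c2)"
    using th by simp
  moreover have "path_image (c1 +++ reversepath c2) = K"
    using th by (simp add: path_image_join K_def)
  ultimately have J: "inside K \<noteq> {} \<and> open (inside K) \<and> connected (inside K) \<and> connected (outside K) \<and>
      frontier (inside K) = K"
    using Jordan_inside_outside[of "c1 +++ reversepath c2"] by simp
  then show "inside K \<noteq> {}" "open (inside K)" "connected (inside K)" "connected (outside K)" by auto
  show "closure (inside K) = inside K \<union> K"
    using J closure_Un_frontier[of "inside K"] by auto
qed

lemma connected_inside_or_outside:
  assumes "connected S" "S \<inter> K = {}"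
  shows "S \<subseteq> inside K \<or> S \<subseteq> outside K"
proof (rule ccontr)
  assume "\<not> ?thesis"
  then obtain x y where xy: "x \<in> S" "x \<notin> inside K" "y \<in> S" "y \<notin> outside K" by auto
  then have x: "x \<in> outside K" and y: "y \<in> inside K"
    using assms(2) inside_Un_outside[of K] by blast+
  have "connected_component (- K) x y"
    using xy assms unfolding connected_component_def by blast
  then have "y \<in> outside K" using x outside_same_component by blast
  then show False using xy by blast
qed

lemma theta_interior_ne:
  assumes "theta c1 c2 c3 p q" shows "path_image c3 - {p, q} \<noteq> {}"
  using assms nonempty_simple_path_endless[of c3] by (auto simp: theta_def arc_imp_simple_path)

text \<open>A connected domain that misses a cycle lies on one side of it. On the bounded side, the
  interior of \<open>c3\<close>, being part of the frontier of the smaller domain, would lie in the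
  closure of the larger one, hence inside or on the cycle of \<open>c1\<close> and
  \<open>c2\<close>; both are excluded.\<close>

lemma theta_insides_disjoint:
  assumes th: "theta c1 c2 c3 p q"
    and out1: "path_image c1 \<inter> inside (path_image c2 \<union> path_image c3) = {}"
    and out3: "path_image c3 \<inter> inside (path_image c1 \<union> path_image c2) = {}"
  shows "inside (path_image c2 \<union> path_image c3) \<subseteq> outside (path_image c1 \<union> path_image c2)"
proof (rule ccontr)
  assume not_out: "\<not> ?thesis"
  have th23: "theta c2 c3 c1 p q" using th theta_swap12 theta_swap23 by blast
  have "inside (path_image c2 \<union> path_image c3) \<inter> (path_image c1 \<union> path_image c2) = {}"
    using out1 inside_no_overlap[of "path_image c2 \<union> path_image c3"] by blast
  with not_out have sub: "inside (path_image c2 \<union> path_image c3) \<subseteq> inside (path_image c1 \<union> path_image c2)"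
    using connected_inside_or_outside theta_inside(3)[OF th23] by blast
  obtain x where x: "x \<in> path_image c3 - {p, q}" using theta_interior_ne[OF th] by blast
  have "x \<in> closure (inside (path_image c1 \<union> path_image c2))"
    using x theta_inside(5)[OF th23] closure_mono[OF sub] by blast
  then have "x \<in> path_image c1 \<union> path_image c2"
    using theta_inside(5)[OF th] out3 x by blast
  then show False using x th by (auto simp: theta_def)
qed

text \<open>If every edge lay outside the other two, then a point inside one of the three cycles would be
  separated from infinity neither by the second nor by the third cycle, hence, by Janiszewski's
  theorem, not by their union.\<close>

lemma theta_some_edge_inside:
  assumes th: "theta c1 c2 c3 p q"
  shows "path_image c1 \<inter> inside (path_image c2 \<union> path_image c3) \<noteq> {} \<or>
    path_image c2 \<inter> inside (path_image c1 \<union> path_image c3) \<noteq> {} \<or>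
    path_image c3 \<inter> inside (path_image c1 \<union> path_image c2) \<noteq> {}"
proof (rule ccontr)
  let ?A = "path_image c1" and ?B = "path_image c2" and ?C = "path_image c3"
  assume neg: "\<not> ?thesis"
  have th132: "theta c1 c3 c2 p q" and th231: "theta c2 c3 c1 p q"
    using th theta_swap12 theta_swap23 by blast+
  obtain x where x: "x \<in> inside (?B \<union> ?C)" using theta_inside(1)[OF th231] by blast
  have compact: "compact ?A" "compact ?B" "compact ?C"
    using th by (auto simp: theta_def compact_arc_image)
  then have "bounded (?A \<union> ?B \<union> ?C)" by (simp add: compact_imp_bounded)
  then obtain r where r: "?A \<union> ?B \<union> ?C \<subseteq> ball 0 r"
    using bounded_subset_ballD[of _ 0] by blast
  have "\<not> bounded (- ball 0 r :: complex set)"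
    using cobounded_imp_unbounded[of "- ball 0 r :: complex set"] by simp
  then obtain y :: complex where y: "y \<notin> ball 0 r" by (metis ComplD bounded_empty equals0I)
  have out: "y \<in> outside T" if "T \<subseteq> ball 0 r" for T
    using outside_subset_convex[OF convex_ball that] y by blast
  have y_out: "y \<in> outside (?A \<union> ?B)" "y \<in> outside (?A \<union> ?C)" "y \<in> outside (?B \<union> ?C)"
    using r by (intro out; blast)+
  have x_out: "x \<in> outside (?A \<union> ?B)" "x \<in> outside (?A \<union> ?C)"
    using x neg theta_insides_disjoint[OF th] theta_insides_disjoint[OF th132]
    by (auto simp: Un_commute)
  have cc: "connected_component (- T) x y" if "connected (outside T)" "x \<in> outside T" "y \<in> outside T" for T
    using that outside_no_overlap[of T] unfolding connected_component_def by blast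
  have "connected_component (- (?A \<union> ?B)) x y" "connected_component (- (?A \<union> ?C)) x y"
    using cc x_out y_out theta_inside(4)[OF th] theta_inside(4)[OF th132] by blast+
  \<comment> \<open>The two cycles share exactly the arc \<open>c1\<close>; Janiszewski's theorem
    asks for this intersection to be connected.\<close>
  moreover have "(?A \<union> ?B) \<inter> (?A \<union> ?C) = ?A" using th by (auto simp: theta_def)
  moreover have "connected ?A" using th by (simp add: theta_def connected_arc_image)
  moreover have "compact (?A \<union> ?B)" "closed (?A \<union> ?C)"
    using compact by (simp_all add: compact_Un compact_imp_closed)
  ultimately have "connected_component (- ((?A \<union> ?B) \<union> (?A \<union> ?C))) x y"
    by (metis Janiszewski)
  then have "connected_component (- (?B \<union> ?C)) x y"
    by (rule connected_component_of_subset) blast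
  then have "x \<in> outside (?B \<union> ?C)"
    using y_out(3) outside_same_component connected_component_sym by blast
  then show False using x inside_Int_outside by blast
qed

text \<open>Running inside the cycle of \<open>c1\<close> and \<open>c2\<close>, the arc
  \<open>c3\<close> splits the inner domain in two. Since \<open>S\<close> accumulates at
  \<open>f\<close>, it lies in the inner domain; being connected, it stays in one half, and the
  closure of that half misses the interior of \<open>c1\<close> or of \<open>c2\<close>.\<close>

lemma theta_no_triod_inside:
  assumes th: "theta c1 c2 c3 p q"
    and ne: "path_image c3 \<inter> inside (path_image c1 \<union> path_image c2) \<noteq> {}"
    and S: "connected S" "S \<inter> (path_image c1 \<union> path_image c2 \<union> path_image c3) = {}"
    and d: "d \<in> closure S" "d \<in> path_image c1 - {p, q}"
    and e: "e \<in> closure S" "e \<in> path_image c2 - {p, q}"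
    and f: "f \<in> closure S" "f \<in> path_image c3 - {p, q}"
  shows False
proof -
  let ?A = "path_image c1" and ?B = "path_image c2" and ?C = "path_image c3"
  have th132: "theta c1 c3 c2 p q" and th231: "theta c2 c3 c1 p q"
    using th theta_swap12 theta_swap23 by blast+
  have "p \<noteq> q" using th arc_distinct_ends[of c1] by (auto simp: theta_def)
  then have eq: "inside (?A \<union> ?C) \<inter> inside (?B \<union> ?C) = {}"
    "inside (?A \<union> ?C) \<union> inside (?B \<union> ?C) \<union> (?C - {p, q}) = inside (?A \<union> ?B)"
    using th ne split_inside_simple_closed_curve[of c1 p q c2 c3]
    by (auto simp: theta_def arc_imp_simple_path)
  have "f \<in> inside (?A \<union> ?B)" using f(2) eq(2) by blast
  then have meets: "S \<inter> inside (?A \<union> ?B) \<noteq> {}"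
    using f(1) theta_inside(2)[OF th] by (metis IntI Int_commute empty_iff open_Int_closure_eq_empty)
  have "S \<subseteq> inside (?A \<union> ?B)"
    using connected_inside_or_outside[of S "?A \<union> ?B"] S meets inside_Int_outside by blast
  then obtain z where z: "z \<in> S" "z \<in> inside (?A \<union> ?C) \<or> z \<in> inside (?B \<union> ?C)"
    using meets eq(2) S(2) by blast
  have no_overlap: "(?A \<union> ?B) \<inter> inside (?A \<union> ?B) = {}" using inside_no_overlap by blast
  from z(2) show False
  proof
    assume "z \<in> inside (?A \<union> ?C)"
    then have "S \<subseteq> inside (?A \<union> ?C)"
      using connected_inside_or_outside[of S "?A \<union> ?C"] S z(1) inside_Int_outside by blast
    then have "e \<in> inside (?A \<union> ?C) \<union> (?A \<union> ?C)"
      using e(1) closure_mono theta_inside(5)[OF th132] by blast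
    moreover have "e \<notin> ?A \<union> ?C" using e(2) th by (auto simp: theta_def)
    ultimately show False using e(2) eq(2) no_overlap by blast
  next
    assume "z \<in> inside (?B \<union> ?C)"
    then have "S \<subseteq> inside (?B \<union> ?C)"
      using connected_inside_or_outside[of S "?B \<union> ?C"] S z(1) inside_Int_outside by blast
    then have "d \<in> inside (?B \<union> ?C) \<union> (?B \<union> ?C)"
      using d(1) closure_mono theta_inside(5)[OF th231] by blast
    moreover have "d \<notin> ?B \<union> ?C" using d(2) th by (auto simp: theta_def)
    ultimately show False using d(2) eq(2) no_overlap by blast
  qed
qed

text \<open>The three arcs play the same role here, so the one that enters the inside of the other
  two may be renamed \<open>c3\<close>.\<close>

lemma theta_no_triod:
  assumes th: "theta c1 c2 c3 p q"
    and S: "connected S" "S \<inter> (path_image c1 \<union> path_image c2 \<union> path_image c3) = {}"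
    and d: "d \<in> closure S" "d \<in> path_image c1 - {p, q}"
    and e: "e \<in> closure S" "e \<in> path_image c2 - {p, q}"
    and f: "f \<in> closure S" "f \<in> path_image c3 - {p, q}"
  shows False
proof -
  have th132: "theta c1 c3 c2 p q" and th231: "theta c2 c3 c1 p q"
    using th theta_swap12 theta_swap23 by blast+
  consider "path_image c1 \<inter> inside (path_image c2 \<union> path_image c3) \<noteq> {}"
    | "path_image c2 \<inter> inside (path_image c1 \<union> path_image c3) \<noteq> {}"
    | "path_image c3 \<inter> inside (path_image c1 \<union> path_image c2) \<noteq> {}"
    using theta_some_edge_inside[OF th] by blast
  then show False
  proof cases
    case 1
    show False by (rule theta_no_triod_inside[OF th231 1 S(1) _ e f d]) (use S(2) in blast)
  next
    case 2
    show False by (rule theta_no_triod_inside[OF th132 2 S(1) _ d f e]) (use S(2) in blast)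
  next
    case 3
    show False by (rule theta_no_triod_inside[OF th 3 S d e f])
  qed
qed

section \<open>From theta curves to drawings of K(3,3)\<close>

text \<open>Supplies the legs of the star: they must avoid the theta curve and yet accumulate at it,
  so the end point is removed.\<close>

lemma connected_arc_minus_finish:
  assumes "arc g"
  shows "connected (path_image g - {pathfinish g})" "pathfinish g \<in> closure (path_image g - {pathfinish g})"
proof -
  have cont: "continuous_on {0..1} g" and inj: "inj_on g {0..1}"
    using assms by (auto simp: arc_def path_def)
  have "g ` ({0..1} - {1}) = g ` {0..1} - g ` {1}"
    by (rule inj_on_image_set_diff[OF inj]) auto
  then have im: "path_image g - {pathfinish g} = g ` {0..<1}"
    by (simp add: path_image_def pathfinish_def atLeastLessThan_eq_atLeastAtMost_diff)
  show "connected (path_image g - {pathfinish g})"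
    unfolding im using cont
    by (intro connected_continuous_image) (auto intro: continuous_on_subset)
  have "g ` closure {0..<1} \<subseteq> closure (g ` {0..<1})"
    using cont by (intro image_closure_subset) (auto simp: closure_subset)
  then show "pathfinish g \<in> closure (path_image g - {pathfinish g})"
    unfolding im by (auto simp: pathfinish_def)
qed

lemma no_K33_drawing:
  fixes pos :: "'a \<Rightarrow> complex" and I :: "'a \<Rightarrow> 'a \<Rightarrow> complex set"
  assumes X: "a \<noteq> b" "a \<noteq> c" "b \<noteq> c" "{a, b, c} \<subseteq> X" and Y: "d \<noteq> e" "d \<noteq> f" "e \<noteq> f" "{d, e, f} \<subseteq> Y"
    and XY: "X \<inter> Y = {}"
    and inj: "inj_on pos (X \<union> Y)"
    and arcs: "\<And>u v. u \<in> X \<Longrightarrow> v \<in> Y \<Longrightarrow>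
      \<exists>g. arc g \<and> pathstart g = pos u \<and> pathfinish g = pos v \<and> path_image g = I u v"
    and meet: "\<And>u v u' v'. u \<in> X \<Longrightarrow> v \<in> Y \<Longrightarrow> u' \<in> X \<Longrightarrow> v' \<in> Y \<Longrightarrow>
      (u, v) \<noteq> (u', v') \<Longrightarrow> I u v \<inter> I u' v' \<subseteq> pos ` ({u, v} \<inter> {u', v'})"
  shows False
proof -
  have ends: "pos u \<in> I u v" "pos v \<in> I u v" if "u \<in> X" "v \<in> Y" for u v
    using arcs[OF that] pathstart_in_path_image pathfinish_in_path_image by metis+
  have disj: "I u v \<inter> I u' v' = {}"
    if "u \<in> X" "v \<in> Y" "u' \<in> X" "v' \<in> Y" "u \<noteq> u'" "v \<noteq> v'" for u v u' v'
  proof -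
    have "{u, v} \<inter> {u', v'} = {}" using that XY by blast
    then show ?thesis using meet[of u v u' v'] that by auto
  qed
  have joinX: "I u v \<inter> I u' v = {pos v}"
    if "u \<in> X" "v \<in> Y" "u' \<in> X" "u \<noteq> u'" for u v u'
  proof -
    have "{u, v} \<inter> {u', v} = {v}" using that XY by blast
    then show ?thesis using meet[of u v u' v] that ends[of u v] ends[of u' v] by simp blast
  qed
  have joinY: "I u v \<inter> I u v' = {pos u}"
    if "u \<in> X" "v \<in> Y" "v' \<in> Y" "v \<noteq> v'" for u v v'
  proof -
    have "{u, v} \<inter> {u, v'} = {u}" using that XY by blast
    then show ?thesis using meet[of u v u v'] that ends[of u v] ends[of u v'] by simp blast
  qed
  have abc: "a \<in> X" "b \<in> X" "c \<in> X" and def: "d \<in> Y" "e \<in> Y" "f \<in> Y"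
    using X Y by auto
  have "\<exists>g. arc g \<and> pathstart g = pos a \<and> pathfinish g = pos b \<and> path_image g = I a v \<union> I b v"
    if v: "v \<in> Y" for v
  proof -
    obtain g h where g: "arc g" "pathstart g = pos a" "pathfinish g = pos v" "path_image g = I a v"
      and h: "arc h" "pathstart h = pos b" "pathfinish h = pos v" "path_image h = I b v"
      using arcs[of a v] arcs[of b v] v abc by metis
    have "arc (g +++ reversepath h)"
      using g h joinX[of a v b] v X(1) abc by (intro arc_join) (auto simp: arc_reversepath)
    moreover have "path_image (g +++ reversepath h) = I a v \<union> I b v"
      using g h by (simp add: path_image_join)
    ultimately show ?thesis using g h by (intro exI[of _ "g +++ reversepath h"]) auto
  qed
  then obtain P where P: "\<And>v. v \<in> Y \<Longrightarrow> arc (P v) \<and> pathstart (P v) = pos a \<and>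
      pathfinish (P v) = pos b \<and> path_image (P v) = I a v \<union> I b v"
    by metis
  have PP: "path_image (P v) \<inter> path_image (P v') = {pos a, pos b}"
    if "v \<in> Y" "v' \<in> Y" "v \<noteq> v'" for v v'
    using P[OF that(1)] P[OF that(2)] joinY[of a v v'] joinY[of b v v'] disj[of a v b v'] disj[of b v a v'] that X(1) abc
    by auto
  have th: "theta (P d) (P e) (P f) (pos a) (pos b)"
    unfolding theta_def using P PP Y(1-3) def by simp
  define S where "S = (\<Union>v\<in>Y. I c v - {pos v})"
  have leg: "connected (I c v - {pos v}) \<and> pos v \<in> closure (I c v - {pos v}) \<and> pos c \<in> I c v - {pos v}"
    if v: "v \<in> Y" for v
  proof -
    obtain g where g: "arc g" "pathstart g = pos c" "pathfinish g = pos v" "path_image g = I c v"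
      using arcs[of c v] v abc by metis
    have "c \<noteq> v" using v XY abc by blast
    then have "pos c \<noteq> pos v" using inj v abc by (auto dest: inj_onD)
    then show ?thesis using connected_arc_minus_finish[OF g(1)] g ends[of c v] v abc by simp
  qed
  have "connected S" unfolding S_def
    by (rule connected_Union) (use leg in blast)+
  moreover have "pos v \<in> closure S" if "v \<in> Y" for v
    using leg[OF that] closure_mono[of "I c v - {pos v}" S] that unfolding S_def by blast
  moreover have "S \<inter> path_image (P v) = {}" if v: "v \<in> Y" for v
  proof -
    have "(I c w - {pos w}) \<inter> (I a v \<union> I b v) = {}" if w: "w \<in> Y" for w
      using joinX[of c v a] joinX[of c v b] disj[of c w a v] disj[of c w b v] v w X(1-3) abc
      by (cases "w = v") auto
    then show ?thesis using P[OF v] unfolding S_def by blast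
  qed
  moreover have "pos v \<in> path_image (P v) - {pos a, pos b}" if v: "v \<in> Y" for v
  proof -
    have "v \<noteq> a" "v \<noteq> b" using v XY abc by auto
    then have "pos v \<noteq> pos a" "pos v \<noteq> pos b" using inj v abc by (auto dest: inj_onD)
    then show ?thesis using P[OF v] ends[of a v] v abc by auto
  qed
  ultimately show False
    using theta_no_triod[OF th, of S "pos d" "pos e" "pos f"] def by (simp add: Int_Un_distrib)
qed

text \<open>Carries the drawing into \<open>complex\<close>, the setting of the Jordan curve
  results; being linear and injective, it preserves arcs.\<close>

definition complex_of_pair :: "real \<times> real \<Rightarrow> complex" where
  "complex_of_pair p = Complex (fst p) (snd p)"

lemma linear_complex_of_pair: "linear complex_of_pair"
  by (rule linearI) (auto simp: complex_of_pair_def complex_eq_iff)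

lemma inj_complex_of_pair: "inj complex_of_pair"
  by (auto simp: complex_of_pair_def inj_def prod_eq_iff)

lemma planar_graph_no_K33:
  assumes "planar_graph V E"
    and V: "{a, b, c, d, e, f} \<subseteq> V"
    and X: "a \<noteq> b" "a \<noteq> c" "b \<noteq> c" and Y: "d \<noteq> e" "d \<noteq> f" "e \<noteq> f"
    and E: "\<And>u v. u \<in> {a, b, c} \<Longrightarrow> v \<in> {d, e, f} \<Longrightarrow> E u v"
    and XY: "{a, b, c} \<inter> {d, e, f} = {}"
  shows False
proof -
  obtain pos :: "'a \<Rightarrow> real \<times> real" and crv :: "'a set \<Rightarrow> real \<Rightarrow> real \<times> real" where
    inj: "inj_on pos V"
    and edge: "\<And>u v. u \<in> V \<Longrightarrow> v \<in> V \<Longrightarrow> E u v \<Longrightarrow> arc (crv {u, v}) \<and>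
          {pathstart (crv {u, v}), pathfinish (crv {u, v})} = {pos u, pos v}"
    and meet: "\<And>u v u' v'. u \<in> V \<Longrightarrow> v \<in> V \<Longrightarrow> u' \<in> V \<Longrightarrow> v' \<in> V \<Longrightarrow> E u v \<Longrightarrow> E u' v' \<Longrightarrow>
          {u, v} \<noteq> {u', v'} \<Longrightarrow>
          path_image (crv {u, v}) \<inter> path_image (crv {u', v'}) \<subseteq> pos ` ({u, v} \<inter> {u', v'})"
    using assms(1) unfolding planar_graph_def by metis
  define I where "I = (\<lambda>u v. path_image (complex_of_pair \<circ> crv {u, v}))"
  show False
  proof (rule no_K33_drawing[OF X subset_refl Y subset_refl XY, of "complex_of_pair \<circ> pos" I])
    have "inj_on pos ({a, b, c} \<union> {d, e, f})" by (rule inj_on_subset[OF inj]) (use V in blast)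
    then show "inj_on (complex_of_pair \<circ> pos) ({a, b, c} \<union> {d, e, f})"
      using inj_complex_of_pair by (meson comp_inj_on inj_on_subset subset_UNIV)
  next
    fix u v assume uv: "u \<in> {a, b, c}" "v \<in> {d, e, f}"
    then have "u \<in> V" "v \<in> V" "E u v" using V E by blast+
    note e = edge[OF this]
    define g where "g = complex_of_pair \<circ> crv {u, v}"
    have g: "arc g" using e arc_linear_image_eq[OF linear_complex_of_pair inj_complex_of_pair]
      by (simp add: g_def)
    have "{pathstart g, pathfinish g} = complex_of_pair ` {pathstart (crv {u, v}), pathfinish (crv {u, v})}"
      by (simp add: g_def pathstart_def pathfinish_def)
    then have "{pathstart g, pathfinish g} = {(complex_of_pair \<circ> pos) u, (complex_of_pair \<circ> pos) v}"
      using e by simp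
    \<comment> \<open>Curves are indexed by unordered pairs, so this one may run from
      \<open>v\<close> to \<open>u\<close> and is then reversed.\<close>
    then consider "pathstart g = (complex_of_pair \<circ> pos) u" "pathfinish g = (complex_of_pair \<circ> pos) v"
      | "pathstart (reversepath g) = (complex_of_pair \<circ> pos) u" "pathfinish (reversepath g) = (complex_of_pair \<circ> pos) v"
      by (auto simp: doubleton_eq_iff)
    then show "\<exists>g. arc g \<and> pathstart g = (complex_of_pair \<circ> pos) u \<and>
        pathfinish g = (complex_of_pair \<circ> pos) v \<and> path_image g = I u v"
    proof cases
      case 1 then show ?thesis using g by (auto simp: I_def g_def)
    next
      case 2
      moreover have "path_image (reversepath g) = I u v" by (simp add: I_def g_def)
      ultimately show ?thesis using arc_reversepath[OF g] by blast
    qed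
  next
    fix u v u' v'
    assume uv: "u \<in> {a, b, c}" "v \<in> {d, e, f}" "u' \<in> {a, b, c}" "v' \<in> {d, e, f}" "(u, v) \<noteq> (u', v')"
    have "{u, v} \<noteq> {u', v'}" using uv XY unfolding doubleton_eq_iff by blast
    moreover have "u \<in> V" "v \<in> V" "u' \<in> V" "v' \<in> V" "E u v" "E u' v'" using uv V E by blast+
    ultimately have "path_image (crv {u, v}) \<inter> path_image (crv {u', v'}) \<subseteq> pos ` ({u, v} \<inter> {u', v'})"
      using meet by blast
    from image_mono[OF this, of complex_of_pair]
    show "I u v \<inter> I u' v' \<subseteq> (complex_of_pair \<circ> pos) ` ({u, v} \<inter> {u', v'})"
      by (simp add: I_def path_image_compose image_Int[OF inj_complex_of_pair, symmetric] image_comp)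
  qed
qed

section \<open>Private regions\<close>

text \<open>\<open>r\<close> and \<open>t\<close> are coordinates of the far ends, not lengths, so
  that crossing and disjointness reduce to order comparisons.\<close>

definition ell :: "real \<Rightarrow> real \<Rightarrow> real \<Rightarrow> real \<Rightarrow> (real \<times> real) set" where
  "ell x y r t = {x} \<times> {y..t} \<union> {x..r} \<times> {y}"

definition is_ell :: "(real \<times> real) set \<Rightarrow> bool" where
  "is_ell S \<longleftrightarrow> (\<exists>x y r t. x < r \<and> y < t \<and> S = ell x y r t)"

lemma is_ell_ell: "x < r \<Longrightarrow> y < t \<Longrightarrow> is_ell (ell x y r t)"
  unfolding is_ell_def by blast

lemma L_shape_eq_ell: "h > 0 \<Longrightarrow> w > 0 \<Longrightarrow> L_shape x y h w = ell x y (x + w) (y + h)"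
  by (auto simp: L_shape_def ell_def closed_segment_same_fst closed_segment_same_snd closed_segment_eq_real_ivl)

lemma is_ell_converse: "is_ell S \<Longrightarrow> is_ell (S\<inverse>)"
proof -
  assume "is_ell S"
  then obtain x y r t where "x < r" "y < t" "S = ell x y r t" by (auto simp: is_ell_def)
  moreover from this have "S\<inverse> = ell y x t r" by (auto simp: ell_def)
  ultimately show ?thesis by (simp add: is_ell_ell)
qed

text \<open>A comb is a horizontal strip with two upward teeth, separated by the vertical part of A;
  the vertical part of B crosses the strip to the right of both teeth, and the horizontal part of C
  crosses both teeth above the strip.\<close>

definition comb :: "(real \<times> real) set \<Rightarrow> (real \<times> real) set \<Rightarrow> (real \<times> real) set \<Rightarrow> (real \<times> real) set \<Rightarrow> bool" where
  "comb C A B R \<longleftrightarrow> (\<exists>x0 x1 xa x2 x3 xb x4 y0 y1 yc y2.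
     x0 < x1 \<and> x1 < xa \<and> xa < x2 \<and> x2 < x3 \<and> x3 < xb \<and> xb < x4 \<and>
     y0 < y1 \<and> y1 < yc \<and> yc < y2 \<and>
     R = {x0..x4} \<times> {y0..y1} \<union> ({x0..x1} \<union> {x2..x3}) \<times> {y0..y2} \<and>
     C \<inter> R = ({x0..x1} \<union> {x2..x3}) \<times> {yc} \<and>
     A \<inter> R = {xa} \<times> {y0..y1} \<and>
     B \<inter> R = {xb} \<times> {y0..y1})"

text \<open>The region of the outer face of the drawing.\<close>

definition halfplane :: "(real \<times> real) set \<Rightarrow> (real \<times> real) set \<Rightarrow> (real \<times> real) set \<Rightarrow> (real \<times> real) set \<Rightarrow> bool" where
  "halfplane P Q S R \<longleftrightarrow> (\<exists>m xp xq xs tp tq ts.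
     xp < xq \<and> xq < xs \<and> m < tp \<and> m < tq \<and> m < ts \<and>
     R = UNIV \<times> {m..} \<and>
     P \<inter> R = {xp} \<times> {m..tp} \<and> Q \<inter> R = {xq} \<times> {m..tq} \<and> S \<inter> R = {xs} \<times> {m..ts})"

text \<open>A set of pairs is a relation, so its converse is its reflection in the diagonal, which
  maps L-shapes to L-shapes.\<close>

inductive good :: "(real \<times> real) set \<Rightarrow> (real \<times> real) set \<Rightarrow> (real \<times> real) set \<Rightarrow> (real \<times> real) set \<Rightarrow> bool" where
  comb: "comb P Q S R \<Longrightarrow> good P Q S R"
| flip: "comb (P\<inverse>) (Q\<inverse>) (S\<inverse>) (R\<inverse>) \<Longrightarrow> good P Q S R"
| halfplane: "halfplane P Q S R \<Longrightarrow> good P Q S R"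
| swap12: "good P Q S R \<Longrightarrow> good Q P S R"
| swap23: "good P Q S R \<Longrightarrow> good P S Q R"

text \<open>A pattern depends only on the traces of the shapes in the region, so it survives when
  shapes are shortened elsewhere.\<close>

lemma good_cong:
  assumes "good P Q S R" "P' \<inter> R = P \<inter> R" "Q' \<inter> R = Q \<inter> R" "S' \<inter> R = S \<inter> R"
  shows "good P' Q' S' R"
  using assms
proof (induction arbitrary: P' Q' S')
  case (comb P Q S R)
  then show ?case by (intro good.comb) (simp add: comb_def)
next
  case (flip P Q S R)
  have "X'\<inverse> \<inter> R\<inverse> = X\<inverse> \<inter> R\<inverse>" if "X' \<inter> R = X \<inter> R" for X X' :: "(real \<times> real) set"
    using that by (metis converse_Int)
  then have "P'\<inverse> \<inter> R\<inverse> = P\<inverse> \<inter> R\<inverse>" "Q'\<inverse> \<inter> R\<inverse> = Q\<inverse> \<inter> R\<inverse>" "S'\<inverse> \<inter> R\<inverse> = S\<inverse> \<inter> R\<inverse>"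
    using flip.prems by blast+
  with flip(1) show ?case unfolding comb_def by (intro good.flip) (simp add: comb_def)
next
  case (halfplane P Q S R)
  then show ?case by (intro good.halfplane) (simp add: halfplane_def)
qed (blast intro: good.swap12 good.swap23)+

section \<open>Drawing a stacked vertex inside a region\<close>

lemma combI:
  assumes "x0 < x1" "x1 < xa" "xa < x2" "x2 < x3" "x3 < xb" "xb < x4" "y0 < y1" "y1 < yc" "yc < y2"
     "R = {x0..x4} \<times> {y0..y1} \<union> ({x0..x1} \<union> {x2..x3}) \<times> {y0..y2}"
     "C \<inter> R = ({x0..x1} \<union> {x2..x3}) \<times> {yc}" "A \<inter> R = {xa} \<times> {y0..y1}" "B \<inter> R = {xb} \<times> {y0..y1}"
  shows "comb C A B R"
  unfolding comb_def using assms by blast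

lemma Int_via_superset: "R' \<subseteq> R \<Longrightarrow> P \<inter> R = T \<Longrightarrow> P \<inter> R' = T \<inter> R'"
  by blast

text \<open>\<open>N\<close> rises in the left tooth across \<open>C\<close> and runs right in the
  strip across \<open>A\<close> and \<open>B\<close>. Below its horizontal arm lies a strip with
  teeth on both sides of \<open>A\<close> reaching up across that arm: a comb with \<open>N\<close>
  in the role of \<open>C\<close>. The rest of each old tooth is a spine crossed by \<open>N\<close>
  and \<open>C\<close>, with prongs to the right below and above \<open>N\<close>. These are
  reflected combs: prongs from the left tooth cross \<open>A\<close>, those from the right tooth
  cross \<open>B\<close>.\<close>

lemma comb_stack:
  assumes "comb C A B R"
  obtains N R1 R2 R3 where "is_ell N" "N \<subseteq> R" "N \<inter> C \<noteq> {}" "N \<inter> A \<noteq> {}" "N \<inter> B \<noteq> {}"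
    "R1 \<union> R2 \<union> R3 \<subseteq> R" "R1 \<inter> R2 = {}" "R1 \<inter> R3 = {}" "R2 \<inter> R3 = {}"
    "comb N A B R1" "comb (B\<inverse>) (N\<inverse>) (C\<inverse>) (R2\<inverse>)" "comb (A\<inverse>) (N\<inverse>) (C\<inverse>) (R3\<inverse>)"
    "C \<inter> R1 = {}" "A \<inter> R2 = {}" "B \<inter> R3 = {}"
proof -
  obtain x0 x1 xa x2 x3 xb x4 y0 y1 yc y2 where
    xs: "x0 < x1" "x1 < xa" "xa < x2" "x2 < x3" "x3 < xb" "xb < x4" and
    ys: "y0 < y1" "y1 < yc" "yc < y2" and
    R: "R = {x0..x4} \<times> {y0..y1} \<union> ({x0..x1} \<union> {x2..x3}) \<times> {y0..y2}" and
    C: "C \<inter> R = ({x0..x1} \<union> {x2..x3}) \<times> {yc}" and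
    A: "A \<inter> R = {xa} \<times> {y0..y1}" and B: "B \<inter> R = {xb} \<times> {y0..y1}"
    using assms unfolding comb_def by (elim exE conjE) (rule that; assumption)
  \<comment> \<open>Left tooth: \<open>n\<close> for the vertical arm of \<open>N\<close>,
    \<open>t1\<close> to \<open>t2\<close> for a tooth of \<open>R1\<close>, \<open>t3\<close> to
    \<open>x1\<close> for the spine of \<open>R3\<close>. Right tooth: \<open>x2\<close> to
    \<open>t4\<close> for \<open>R1\<close>, \<open>t5\<close> to \<open>x3\<close> for the spine of
    \<open>R2\<close>. The prongs of \<open>R3\<close> end at \<open>e\<close>, between
    \<open>A\<close> and the right tooth. The horizontal arm of \<open>N\<close> has height
    \<open>q\<close>, and the prongs occupy \<open>q2\<close> to \<open>q3\<close> and
    \<open>q4\<close> to \<open>y1\<close>.\<close>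
  obtain n where n: "x0 < n" "n < x1" using dense xs(1) by blast
  obtain t1 where t1: "n < t1" "t1 < x1" using dense n by blast
  obtain t2 where t2: "t1 < t2" "t2 < x1" using dense t1 by blast
  obtain t3 where t3: "t2 < t3" "t3 < x1" using dense t2 by blast
  obtain e where e: "xa < e" "e < x2" using dense xs by blast
  obtain t4 where t4: "x2 < t4" "t4 < x3" using dense xs by blast
  obtain t5 where t5: "t4 < t5" "t5 < x3" using dense t4 by blast
  obtain q where q: "y0 < q" "q < y1" using dense ys(1) by blast
  obtain q1 where q1: "y0 < q1" "q1 < q" using dense q by blast
  obtain q2 where q2: "q1 < q2" "q2 < q" using dense q1 by blast
  obtain q3 where q3: "q2 < q3" "q3 < q" using dense q2 by blast
  obtain q4 where q4: "q < q4" "q4 < y1" using dense q by blast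
  note ord = xs ys n t1 t2 t3 e t4 t5 q q1 q2 q3 q4
  define N where "N = ell n q x4 y2"
  define R1 where "R1 = {t1..x4} \<times> {y0..q1} \<union> ({t1..t2} \<union> {x2..t4}) \<times> {y0..q4}"
  define R2 where "R2 = {t5..x3} \<times> {q2..y2} \<union> {t5..x4} \<times> ({q2..q3} \<union> {q4..y1})"
  define R3 where "R3 = {t3..x1} \<times> {q2..y2} \<union> {t3..e} \<times> ({q2..q3} \<union> {q4..y1})"
  have sub: "R1 \<subseteq> R" "R2 \<subseteq> R" "R3 \<subseteq> R" "N \<subseteq> R"
    unfolding R1_def R2_def R3_def R N_def ell_def using ord by auto
  \<comment> \<open>The old shapes are known only through their traces in \<open>R\<close>; their
    traces in the new regions are computed from these.\<close>
  note int1 = Int_via_superset[OF sub(1) A] Int_via_superset[OF sub(1) B] Int_via_superset[OF sub(1) C]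
  note int2 = Int_via_superset[OF sub(2) A] Int_via_superset[OF sub(2) B] Int_via_superset[OF sub(2) C]
  note int3 = Int_via_superset[OF sub(3) A] Int_via_superset[OF sub(3) B] Int_via_superset[OF sub(3) C]
  show thesis
  proof
    show "is_ell N" unfolding N_def using ord by (intro is_ell_ell) auto
    show "N \<subseteq> R" by (rule sub)
    have "(n, yc) \<in> N" "(n, yc) \<in> C \<inter> R" "(xa, q) \<in> N" "(xa, q) \<in> A \<inter> R" "(xb, q) \<in> N" "(xb, q) \<in> B \<inter> R"
      unfolding A B C N_def ell_def using ord by auto
    then show "N \<inter> C \<noteq> {}" "N \<inter> A \<noteq> {}" "N \<inter> B \<noteq> {}" by blast+
    show "R1 \<union> R2 \<union> R3 \<subseteq> R" using sub by blast
    show "R1 \<inter> R2 = {}" "R1 \<inter> R3 = {}" "R2 \<inter> R3 = {}"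
      unfolding R1_def R2_def R3_def using ord by auto
    show "C \<inter> R1 = {}" unfolding int1 unfolding R1_def using ord by auto
    show "A \<inter> R2 = {}" unfolding int2 unfolding R2_def using ord by auto
    show "B \<inter> R3 = {}" unfolding int3 unfolding R3_def using ord by auto
    show "comb N A B R1"
    proof (rule combI[of t1 t2 xa x2 t4 xb x4 y0 q1 q q4])
      show "N \<inter> R1 = ({t1..t2} \<union> {x2..t4}) \<times> {q}"
        unfolding R1_def N_def ell_def using ord by auto
      show "A \<inter> R1 = {xa} \<times> {y0..q1}" "B \<inter> R1 = {xb} \<times> {y0..q1}"
        unfolding int1 unfolding R1_def using ord by auto
    qed (use ord in \<open>auto simp: R1_def\<close>)
    \<comment> \<open>After reflection \<open>B\<close> crosses the two prongs, \<open>N\<close>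
      separates them, and \<open>C\<close> crosses the spine beyond both.\<close>
    show "comb (B\<inverse>) (N\<inverse>) (C\<inverse>) (R2\<inverse>)"
    proof (rule combI[of q2 q3 q q4 y1 yc y2 t5 x3 xb x4])
      have "N \<inter> R2 = {t5..x3} \<times> {q}"
        unfolding R2_def N_def ell_def using ord by auto
      then show "N\<inverse> \<inter> R2\<inverse> = {q} \<times> {t5..x3}" by (simp add: converse_Times flip: converse_Int)
      have "C \<inter> R2 = {t5..x3} \<times> {yc}" "B \<inter> R2 = {xb} \<times> ({q2..q3} \<union> {q4..y1})"
        unfolding int2 unfolding R2_def using ord by auto
      then show "C\<inverse> \<inter> R2\<inverse> = {yc} \<times> {t5..x3}" "B\<inverse> \<inter> R2\<inverse> = ({q2..q3} \<union> {q4..y1}) \<times> {xb}"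
        by (simp_all add: converse_Times flip: converse_Int)
    qed (use ord in \<open>auto simp: R2_def\<close>)
    show "comb (A\<inverse>) (N\<inverse>) (C\<inverse>) (R3\<inverse>)"
    proof (rule combI[of q2 q3 q q4 y1 yc y2 t3 x1 xa e])
      have "N \<inter> R3 = {t3..x1} \<times> {q}"
        unfolding R3_def N_def ell_def using ord by auto
      then show "N\<inverse> \<inter> R3\<inverse> = {q} \<times> {t3..x1}" by (simp add: converse_Times flip: converse_Int)
      have "C \<inter> R3 = {t3..x1} \<times> {yc}" "A \<inter> R3 = {xa} \<times> ({q2..q3} \<union> {q4..y1})"
        unfolding int3 unfolding R3_def using ord by auto
      then show "C\<inverse> \<inter> R3\<inverse> = {yc} \<times> {t3..x1}" "A\<inverse> \<inter> R3\<inverse> = ({q2..q3} \<union> {q4..y1}) \<times> {xa}"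
        by (simp_all add: converse_Times flip: converse_Int)
    qed (use ord in \<open>auto simp: R3_def\<close>)
  qed
qed

text \<open>The new shape crosses all three verticals from the left; cutting the middle one just above
  the crossing keeps three uncut verticals for the next outer face.\<close>

lemma halfplane_stack:
  assumes "halfplane P Q S R" "is_ell Q"
  obtains N Q' R1 R2 R3 where "is_ell N" "is_ell Q'" "N \<subseteq> R" "Q' \<subseteq> Q" "Q - R \<subseteq> Q'"
    "N \<inter> P \<noteq> {}" "N \<inter> Q' \<noteq> {}" "N \<inter> S \<noteq> {}" "P \<inter> Q \<inter> R = {}" "Q \<inter> S \<inter> R = {}"
    "R1 \<union> R2 \<union> R3 \<subseteq> R" "R1 \<inter> R2 = {}" "R1 \<inter> R3 = {}" "R2 \<inter> R3 = {}"
    "comb N Q' S R1" "halfplane N P S R2" "comb N P Q' R3"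
    "P \<inter> R1 = {}" "Q' \<inter> R2 = {}" "S \<inter> R3 = {}"
proof -
  obtain m xp xq xs tp tq ts where
    xs: "xp < xq" "xq < xs" and ts: "m < tp" "m < tq" "m < ts" and
    R: "R = UNIV \<times> {m..}" and
    P: "P \<inter> R = {xp} \<times> {m..tp}" and Q: "Q \<inter> R = {xq} \<times> {m..tq}" and S: "S \<inter> R = {xs} \<times> {m..ts}"
    using assms(1) unfolding halfplane_def by (elim exE conjE) (rule that; assumption)
  obtain x y r t where ell: "x < r" "y < t" "Q = ell x y r t"
    using assms(2) by (auto simp: is_ell_def)
  \<comment> \<open>Otherwise both ends of the horizontal arm of \<open>Q\<close>, with different
    abscissas, would belong to its vertical trace. Hence a cut inside the half-plane leaves an
    L-shape.\<close>
  have "y < m"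
  proof (rule ccontr)
    assume "\<not> y < m"
    then have "(x, y) \<in> Q \<inter> R" "(r, y) \<in> Q \<inter> R" using ell by (auto simp: R ell_def)
    then show False unfolding Q using ell by auto
  qed
  have "x = xq \<and> tq \<le> t"
  proof -
    have "(xq, tq) \<in> Q \<inter> R" unfolding Q using ts by auto
    then show ?thesis using \<open>y < m\<close> ts by (auto simp: ell ell_def)
  qed
  note xy = \<open>y < m\<close> this
  \<comment> \<open>Top of the shortest trace: all crossings are placed below it, where all three
    verticals are present.\<close>
  define l where "l = min tp (min tq ts)"
  have l: "m < l" "l \<le> tp" "l \<le> tq" "l \<le> ts" using ts by (auto simp: l_def)
  obtain q where q: "m < q" "q < l" using dense l(1) by blast
  obtain q1 where q1: "m < q1" "q1 < q" using dense q by blast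
  obtain q2 where q2: "q1 < q2" "q2 < q" using dense q1 by blast
  obtain q3 where q3: "q2 < q3" "q3 < q" using dense q2 by blast
  obtain q4 where q4: "q < q4" "q4 < l" using dense q by blast
  obtain q5 where q5: "q4 < q5" "q5 < l" using dense q4 by blast
  obtain u1 where u1: "xp < u1" "u1 < xq" using dense xs by blast
  obtain u2 where u2: "u1 < u2" "u2 < xq" using dense u1 by blast
  obtain u3 where u3: "u2 < u3" "u3 < xq" using dense u2 by blast
  obtain u4 where u4: "u3 < u4" "u4 < xq" using dense u3 by blast
  obtain u5 where u5: "xq < u5" "u5 < xs" using dense xs by blast
  obtain u6 where u6: "u5 < u6" "u6 < xs" using dense u5 by blast
  note ord = xs l q q1 q2 q3 q4 q5 u1 u2 u3 u4 u5 u6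
  \<comment> \<open>The offset 3 leaves room for a tooth of \<open>R3\<close> between the vertical
    arm of \<open>N\<close> and \<open>P\<close>. As \<open>l\<close> exceeds \<open>q5\<close>,
    that arm reaches into \<open>R2\<close> as its leftmost vertical; \<open>Q'\<close> ends at
    \<open>q4\<close>, above the crossing at \<open>q\<close> and below \<open>R2\<close>.\<close>
  define N where "N = ell (xp - 3) q (xs + 1) l"
  define Q' where "Q' = ell xq y r q4"
  \<comment> \<open>\<open>R3\<close> stays below \<open>q1\<close> except for teeth left of
    \<open>u2\<close>, while \<open>R1\<close> stays above \<open>q2\<close> and right of
    \<open>u3\<close>; so the two combs are disjoint.\<close>
  define R1 where "R1 = {u3..xs + 1} \<times> {q2..q3} \<union> ({u3..u4} \<union> {u5..u6}) \<times> {q2..q4}"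
  define R2 where "R2 = (UNIV :: real set) \<times> {q5..}"
  define R3 where "R3 = {xp - 2..u5} \<times> {m..q1} \<union> ({xp - 2..xp - 1} \<union> {u1..u2}) \<times> {m..q4}"
  have sub: "R1 \<subseteq> R" "R2 \<subseteq> R" "R3 \<subseteq> R" "N \<subseteq> R"
    unfolding R1_def R2_def R3_def R N_def ell_def using ord by auto
  have Q'R: "Q' \<inter> R = {xq} \<times> {m..q4}"
    unfolding Q'_def R ell_def using xy by auto
  note int1 = Int_via_superset[OF sub(1) P] Int_via_superset[OF sub(1) Q'R] Int_via_superset[OF sub(1) S]
  note int2 = Int_via_superset[OF sub(2) P] Int_via_superset[OF sub(2) Q'R] Int_via_superset[OF sub(2) S]
  note int3 = Int_via_superset[OF sub(3) P] Int_via_superset[OF sub(3) Q'R] Int_via_superset[OF sub(3) S]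
  show thesis
  proof
    show "is_ell N" unfolding N_def using ord by (intro is_ell_ell) auto
    show "is_ell Q'" unfolding Q'_def using ord xy ell by (intro is_ell_ell) auto
    show "N \<subseteq> R" by (rule sub)
    show "Q' \<subseteq> Q" "Q - R \<subseteq> Q'"
      unfolding ell(3) Q'_def ell_def R using xy ord by auto
    have "(xp, q) \<in> N" "(xp, q) \<in> P \<inter> R" "(xq, q) \<in> N" "(xq, q) \<in> Q' \<inter> R" "(xs, q) \<in> N" "(xs, q) \<in> S \<inter> R"
      unfolding P Q'R S N_def ell_def using ord by auto
    then show "N \<inter> P \<noteq> {}" "N \<inter> Q' \<noteq> {}" "N \<inter> S \<noteq> {}" by blast+
    \<comment> \<open>Cutting \<open>Q\<close> inside \<open>R\<close> thus destroys no intersection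
      with \<open>P\<close> or \<open>S\<close>.\<close>
    have "(P \<inter> R) \<inter> (Q \<inter> R) = {}" "(Q \<inter> R) \<inter> (S \<inter> R) = {}"
      unfolding P Q S using xs by auto
    then show "P \<inter> Q \<inter> R = {}" "Q \<inter> S \<inter> R = {}" by blast+
    show "R1 \<union> R2 \<union> R3 \<subseteq> R" using sub by blast
    show "R1 \<inter> R2 = {}" "R1 \<inter> R3 = {}" "R2 \<inter> R3 = {}"
      unfolding R1_def R2_def R3_def using ord by auto
    show "P \<inter> R1 = {}" unfolding int1 unfolding R1_def using ord by auto
    show "Q' \<inter> R2 = {}" unfolding int2 unfolding R2_def using ord by auto
    show "S \<inter> R3 = {}" unfolding int3 unfolding R3_def using ord by auto
    show "comb N Q' S R1"
    proof (rule combI[of u3 u4 xq u5 u6 xs "xs + 1" q2 q3 q q4])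
      show "N \<inter> R1 = ({u3..u4} \<union> {u5..u6}) \<times> {q}"
        unfolding R1_def N_def ell_def using ord by auto
      show "Q' \<inter> R1 = {xq} \<times> {q2..q3}" "S \<inter> R1 = {xs} \<times> {q2..q3}"
        unfolding int1 unfolding R1_def using ord by auto
    qed (use ord in \<open>auto simp: R1_def\<close>)
    show "comb N P Q' R3"
    proof (rule combI[of "xp - 2" "xp - 1" xp u1 u2 xq u5 m q1 q q4])
      show "N \<inter> R3 = ({xp - 2..xp - 1} \<union> {u1..u2}) \<times> {q}"
        unfolding R3_def N_def ell_def using ord by auto
      show "P \<inter> R3 = {xp} \<times> {m..q1}" "Q' \<inter> R3 = {xq} \<times> {m..q1}"
        unfolding int3 unfolding R3_def using ord by auto
    qed (use ord in \<open>auto simp: R3_def\<close>)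
    show "halfplane N P S R2"
      unfolding halfplane_def
    proof (intro exI conjI)
      show "N \<inter> R2 = {xp - 3} \<times> {q5..l}"
        unfolding R2_def N_def ell_def using ord by auto
      show "P \<inter> R2 = {xp} \<times> {q5..tp}" "S \<inter> R2 = {xs} \<times> {q5..ts}"
        unfolding int2 unfolding R2_def using ord by auto
      show "R2 = UNIV \<times> {q5..}" by (rule R2_def)
    qed (use ord in auto)
  qed
qed

text \<open>The shapes P, Q, S may be shortened inside R to P', Q', S' when N is drawn; the index of each
  new region tells which of the three old shapes it avoids.\<close>

definition stacking where
  "stacking P Q S R P' Q' S' N R1 R2 R3 \<longleftrightarrow>
     is_ell P' \<and> is_ell Q' \<and> is_ell S' \<and> is_ell N \<and>
     P' \<subseteq> P \<and> P - R \<subseteq> P' \<and> Q' \<subseteq> Q \<and> Q - R \<subseteq> Q' \<and> S' \<subseteq> S \<and> S - R \<subseteq> S' \<and>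
     (P \<inter> Q \<noteq> {} \<longrightarrow> P' \<inter> Q' \<noteq> {}) \<and> (P \<inter> S \<noteq> {} \<longrightarrow> P' \<inter> S' \<noteq> {}) \<and> (Q \<inter> S \<noteq> {} \<longrightarrow> Q' \<inter> S' \<noteq> {}) \<and>
     N \<subseteq> R \<and> N \<inter> P' \<noteq> {} \<and> N \<inter> Q' \<noteq> {} \<and> N \<inter> S' \<noteq> {} \<and>
     R1 \<union> R2 \<union> R3 \<subseteq> R \<and> R1 \<inter> R2 = {} \<and> R1 \<inter> R3 = {} \<and> R2 \<inter> R3 = {} \<and>
     good N Q' S' R1 \<and> good N P' S' R2 \<and> good N P' Q' R3 \<and>
     P' \<inter> R1 = {} \<and> Q' \<inter> R2 = {} \<and> S' \<inter> R3 = {}"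

text \<open>The flipped comb is handled by reflecting the result for the comb. The permutations only
  reorder the new regions, so that each index keeps naming the avoided shape.\<close>

lemma good_stacking:
  assumes "good P Q S R" "is_ell P" "is_ell Q" "is_ell S"
  shows "\<exists>P' Q' S' N R1 R2 R3. stacking P Q S R P' Q' S' N R1 R2 R3"
  using assms
proof induction
  case (comb P Q S R)
  from comb(1) obtain N R1 R2 R3 where N: "is_ell N" "N \<subseteq> R" "N \<inter> P \<noteq> {}" "N \<inter> Q \<noteq> {}" "N \<inter> S \<noteq> {}"
    "R1 \<union> R2 \<union> R3 \<subseteq> R" "R1 \<inter> R2 = {}" "R1 \<inter> R3 = {}" "R2 \<inter> R3 = {}"
    "comb N Q S R1" "comb (S\<inverse>) (N\<inverse>) (P\<inverse>) (R2\<inverse>)" "comb (Q\<inverse>) (N\<inverse>) (P\<inverse>) (R3\<inverse>)"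
    "P \<inter> R1 = {}" "Q \<inter> R2 = {}" "S \<inter> R3 = {}"
    by (rule comb_stack)
  have "good N Q S R1" "good N P S R2" "good N P Q R3"
    by (rule good.comb[OF N(10)] good.swap23[OF good.swap12[OF good.flip[OF N(11)]]]
        good.swap23[OF good.swap12[OF good.flip[OF N(12)]]])+
  with comb N have "stacking P Q S R P Q S N R1 R2 R3" by (simp add: stacking_def)
  then show ?case by blast
next
  case (flip P Q S R)
  from flip(1) obtain N R1 R2 R3 where N: "is_ell N" "N \<subseteq> R\<inverse>" "N \<inter> P\<inverse> \<noteq> {}" "N \<inter> Q\<inverse> \<noteq> {}" "N \<inter> S\<inverse> \<noteq> {}"
    "R1 \<union> R2 \<union> R3 \<subseteq> R\<inverse>" "R1 \<inter> R2 = {}" "R1 \<inter> R3 = {}" "R2 \<inter> R3 = {}"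
    "comb N (Q\<inverse>) (S\<inverse>) R1" "comb ((S\<inverse>)\<inverse>) (N\<inverse>) ((P\<inverse>)\<inverse>) (R2\<inverse>)" "comb ((Q\<inverse>)\<inverse>) (N\<inverse>) ((P\<inverse>)\<inverse>) (R3\<inverse>)"
    "P\<inverse> \<inter> R1 = {}" "Q\<inverse> \<inter> R2 = {}" "S\<inverse> \<inter> R3 = {}"
    by (rule comb_stack)
  have "good (N\<inverse>) Q S (R1\<inverse>)"
    using N(10) by (intro good.flip) simp
  moreover have "good (N\<inverse>) P S (R2\<inverse>)" "good (N\<inverse>) P Q (R3\<inverse>)"
    by (rule good.swap23[OF good.swap12[OF good.comb]], use N(11,12) in simp)+
  moreover have "N\<inverse> \<inter> P \<noteq> {}" "N\<inverse> \<inter> Q \<noteq> {}" "N\<inverse> \<inter> S \<noteq> {}" "N\<inverse> \<subseteq> R"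
    "R1\<inverse> \<union> R2\<inverse> \<union> R3\<inverse> \<subseteq> R" "R1\<inverse> \<inter> R2\<inverse> = {}" "R1\<inverse> \<inter> R3\<inverse> = {}" "R2\<inverse> \<inter> R3\<inverse> = {}"
    "P \<inter> R1\<inverse> = {}" "Q \<inter> R2\<inverse> = {}" "S \<inter> R3\<inverse> = {}"
    using N(2-9,13-15) by blast+
  ultimately have "stacking P Q S R P Q S (N\<inverse>) (R1\<inverse>) (R2\<inverse>) (R3\<inverse>)"
    using flip(2-4) is_ell_converse[OF N(1)] by (simp add: stacking_def)
  then show ?case by blast
next
  case (halfplane P Q S R)
  from halfplane(1,3) obtain N Q' R1 R2 R3 where N: "is_ell N" "is_ell Q'" "N \<subseteq> R" "Q' \<subseteq> Q" "Q - R \<subseteq> Q'"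
    "N \<inter> P \<noteq> {}" "N \<inter> Q' \<noteq> {}" "N \<inter> S \<noteq> {}" "P \<inter> Q \<inter> R = {}" "Q \<inter> S \<inter> R = {}"
    "R1 \<union> R2 \<union> R3 \<subseteq> R" "R1 \<inter> R2 = {}" "R1 \<inter> R3 = {}" "R2 \<inter> R3 = {}"
    "comb N Q' S R1" "halfplane N P S R2" "comb N P Q' R3"
    "P \<inter> R1 = {}" "Q' \<inter> R2 = {}" "S \<inter> R3 = {}"
    by (rule halfplane_stack)
  have "good N Q' S R1" "good N P S R2" "good N P Q' R3"
    by (rule good.comb[OF N(15)] good.halfplane[OF N(16)] good.comb[OF N(17)])+
  moreover have "P \<inter> Q \<noteq> {} \<longrightarrow> P \<inter> Q' \<noteq> {}" "Q \<inter> S \<noteq> {} \<longrightarrow> Q' \<inter> S \<noteq> {}"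
    using N(5,9,10) by blast+
  ultimately have "stacking P Q S R P Q' S N R1 R2 R3"
    using halfplane(2-4) N(1-8,11-14,18-20) by (simp add: stacking_def)
  then show ?case by blast
next
  case (swap12 P Q S R)
  then obtain P' Q' S' N R1 R2 R3 where "stacking P Q S R P' Q' S' N R1 R2 R3" by blast
  then have "stacking Q P S R Q' P' S' N R2 R1 R3"
    unfolding stacking_def using good.swap23[of N P' Q' R3] by (simp add: Int_commute)
  then show ?case by blast
next
  case (swap23 P Q S R)
  then obtain P' Q' S' N R1 R2 R3 where "stacking P Q S R P' Q' S' N R1 R2 R3" by blast
  then have "stacking P S Q R P' S' Q' N R1 R3 R2"
    unfolding stacking_def using good.swap23[of N Q' S' R1] by (simp add: Int_commute)
  then show ?case by blast
qed

section \<open>Stacked triangulations\<close>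

text \<open>The triangle can be an unordered set because \<open>good\<close> is closed under
  permutations of the three shapes.\<close>

definition face :: "'a set \<Rightarrow> ('a \<Rightarrow> (real \<times> real) set) \<Rightarrow> 'a set \<Rightarrow> (real \<times> real) set \<Rightarrow> bool" where
  "face V s t R \<longleftrightarrow> (\<exists>a b c. t = {a, b, c} \<and> t \<subseteq> V \<and> a \<noteq> b \<and> a \<noteq> c \<and> b \<noteq> c \<and>
     good (s a) (s b) (s c) R \<and> (\<forall>v\<in>V - t. s v \<inter> R = {}))"

lemma faceI:
  assumes "t = {a, b, c}" "t \<subseteq> V" "a \<noteq> b" "a \<noteq> c" "b \<noteq> c" "good (s a) (s b) (s c) R"
    "\<And>v. v \<in> V \<Longrightarrow> v \<notin> t \<Longrightarrow> s v \<inter> R = {}"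
  shows "face V s t R"
  unfolding face_def using assms by blast

lemma faceE:
  assumes "face V s t R"
  obtains a b c where "t = {a, b, c}" "t \<subseteq> V" "a \<noteq> b" "a \<noteq> c" "b \<noteq> c" "good (s a) (s b) (s c) R"
    "\<forall>v\<in>V - t. s v \<inter> R = {}"
  using assms unfolding face_def by blast

text \<open>Regions are paired with triangles rather than indexed by them because the initial triangle
  has two regions, one for each side.\<close>

definition packing :: "'a set \<Rightarrow> ('a \<Rightarrow> 'a \<Rightarrow> bool) \<Rightarrow> ('a \<Rightarrow> (real \<times> real) set) \<Rightarrow> ('a set \<times> (real \<times> real) set) set \<Rightarrow> bool" where
  "packing V E s F \<longleftrightarrow>
     (\<forall>v\<in>V. is_ell (s v)) \<and>
     (\<forall>u\<in>V. \<forall>v\<in>V. u \<noteq> v \<longrightarrow> (E u v \<longleftrightarrow> s u \<inter> s v \<noteq> {})) \<and>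
     (\<forall>t R. (t, R) \<in> F \<longrightarrow> face V s t R) \<and>
     (\<forall>X\<in>F. \<forall>Y\<in>F. X \<noteq> Y \<longrightarrow> snd X \<inter> snd Y = {})"

text \<open>\<open>N\<close> stays inside \<open>R\<close>, which only the shapes of
  \<open>t\<close> enter, so it meets exactly those. The cuts also happen inside \<open>R\<close>,
  so the regions in \<open>F\<close>, being disjoint from \<open>R\<close>, keep their patterns.
  Agreement of \<open>E'\<close> with \<open>E\<close> is asked only on \<open>V\<close>, so
  \<open>(\<noteq>)\<close> can serve as edge relation of the initial triangle.\<close>

lemma packing_stack:
  assumes pack: "packing V E s (insert (t, R) F)" "(t, R) \<notin> F" and n: "n \<notin> V"
    and old: "\<And>u v. u \<in> V \<Longrightarrow> v \<in> V \<Longrightarrow> E' u v \<longleftrightarrow> E u v"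
    and new: "\<And>u. u \<in> V \<Longrightarrow> (E' n u \<longleftrightarrow> u \<in> t) \<and> (E' u n \<longleftrightarrow> u \<in> t)"
  obtains s' F' where "packing (insert n V) E' s' F'" "F \<subseteq> F'"
    "\<forall>u\<in>t. \<forall>v\<in>t. u \<noteq> v \<longrightarrow> {n, u, v} \<in> fst ` F'"
proof -
  note pack_def = pack(1)[unfolded packing_def]
  have ell: "\<And>v. v \<in> V \<Longrightarrow> is_ell (s v)"
    using pack_def[THEN conjunct1] by blast
  have adj: "\<And>u v. u \<in> V \<Longrightarrow> v \<in> V \<Longrightarrow> u \<noteq> v \<Longrightarrow> E u v \<longleftrightarrow> s u \<inter> s v \<noteq> {}"
    using pack_def[THEN conjunct2, THEN conjunct1] by blast
  note reg = pack_def[THEN conjunct2, THEN conjunct2, THEN conjunct1, rule_format]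
  note disj = pack_def[THEN conjunct2, THEN conjunct2, THEN conjunct2, rule_format]
  have disjR: "S \<inter> R = {}" if "(u, S) \<in> F" for u S
  proof -
    have "(u, S) \<noteq> (t, R)" using that pack(2) by blast
    then show ?thesis using disj[of "(u, S)" "(t, R)"] that by simp
  qed
  obtain a b c where t: "t = {a, b, c}" "t \<subseteq> V" and abc: "a \<noteq> b" "a \<noteq> c" "b \<noteq> c"
    and good: "good (s a) (s b) (s c) R" and avoids_R: "\<forall>v\<in>V - t. s v \<inter> R = {}"
    by (rule faceE[OF reg[OF insertI1]])
  have avoid: "\<And>v. v \<in> V \<Longrightarrow> v \<notin> t \<Longrightarrow> s v \<inter> R = {}" using avoids_R by blast
  have abcV: "a \<in> V" "b \<in> V" "c \<in> V" using t by auto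
  then have abcn: "a \<noteq> n" "b \<noteq> n" "c \<noteq> n" using n by auto
  obtain P' Q' S' N R1 R2 R3 where "stacking (s a) (s b) (s c) R P' Q' S' N R1 R2 R3"
    using good_stacking[OF good ell[OF abcV(1)] ell[OF abcV(2)] ell[OF abcV(3)]] by blast
  then have ells: "is_ell P'" "is_ell Q'" "is_ell S'" "is_ell N"
    and sub: "P' \<subseteq> s a" "s a - R \<subseteq> P'" "Q' \<subseteq> s b" "s b - R \<subseteq> Q'" "S' \<subseteq> s c" "s c - R \<subseteq> S'"
    and meets: "s a \<inter> s b \<noteq> {} \<longrightarrow> P' \<inter> Q' \<noteq> {}" "s a \<inter> s c \<noteq> {} \<longrightarrow> P' \<inter> S' \<noteq> {}" "s b \<inter> s c \<noteq> {} \<longrightarrow> Q' \<inter> S' \<noteq> {}"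
    and N: "N \<subseteq> R" "N \<inter> P' \<noteq> {}" "N \<inter> Q' \<noteq> {}" "N \<inter> S' \<noteq> {}"
    and Ri: "R1 \<subseteq> R" "R2 \<subseteq> R" "R3 \<subseteq> R" "R1 \<inter> R2 = {}" "R1 \<inter> R3 = {}" "R2 \<inter> R3 = {}"
    and goods: "good N Q' S' R1" "good N P' S' R2" "good N P' Q' R3"
    and avoids: "P' \<inter> R1 = {}" "Q' \<inter> R2 = {}" "S' \<inter> R3 = {}"
    unfolding stacking_def by simp_all
  define s' where "s' = s(a := P', b := Q', c := S', n := N)"
  have s'[simp]: "s' a = P'" "s' b = Q'" "s' c = S'" "s' n = N"
    unfolding s'_def using abc abcn by auto
  have s'_other: "s' v = s v" if "v \<in> V" "v \<notin> t" for v
    using that n t unfolding s'_def by auto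
  have shrink: "s' v \<subseteq> s v \<and> s v - R \<subseteq> s' v" if "v \<in> V" for v
    using sub s'_other[OF that] t(1) by (cases "v \<in> t") auto
  define F' where "F' = F \<union> {({n, b, c}, R1), ({n, a, c}, R2), ({n, a, b}, R3)}"
  have pack': "packing (insert n V) E' s' F'"
    unfolding packing_def
  proof (intro conjI ballI allI impI)
    fix v assume "v \<in> insert n V"
    then show "is_ell (s' v)" using ells ell s'_other t(1) by (cases "v \<in> t") auto
  next
    fix u v assume uv: "u \<in> insert n V" "v \<in> insert n V" "u \<noteq> v"
    have N_meets: "N \<inter> s' w \<noteq> {} \<longleftrightarrow> w \<in> t" if "w \<in> V" for w
      using N t(1) s'_other[OF that] avoid[OF that] by (cases "w \<in> t") auto
    consider "u = n" "v \<in> V" | "v = n" "u \<in> V" | "u \<in> V" "v \<in> V" using uv by blast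
    then show "E' u v \<longleftrightarrow> s' u \<inter> s' v \<noteq> {}"
    proof cases
      case 1
      then show ?thesis using new N_meets by simp
    next
      case 2
      then show ?thesis using new N_meets by (simp add: Int_commute)
    next
      case 3
      \<comment> \<open>An intersection is at risk only inside \<open>R\<close>, hence only between
        two corners of \<open>t\<close>, and there \<open>meets\<close> preserves it.\<close>
      have "s u \<inter> s v \<noteq> {} \<longleftrightarrow> s' u \<inter> s' v \<noteq> {}"
      proof
        assume ne: "s u \<inter> s v \<noteq> {}"
        show "s' u \<inter> s' v \<noteq> {}"
        proof (cases "u \<in> t \<and> v \<in> t")
          case True
          then show ?thesis using ne meets uv(3) unfolding t(1) by (auto simp: Int_commute)
        next
          case False
          then have "s u \<inter> s v \<inter> R = {}" using avoid 3 by blast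
          then show ?thesis using ne shrink[OF 3(1)] shrink[OF 3(2)] by blast
        qed
      next
        assume "s' u \<inter> s' v \<noteq> {}"
        then show "s u \<inter> s v \<noteq> {}" using shrink[OF 3(1)] shrink[OF 3(2)] by blast
      qed
      then show ?thesis using 3 old adj uv(3) by simp
    qed
  next
    fix u S assume X: "(u, S) \<in> F'"
    have other: "s' v \<inter> S = {}" if "v \<in> V - t" "S \<subseteq> R" for v S
      using that avoid s'_other by blast
    consider "(u, S) \<in> F" | "u = {n, b, c}" "S = R1" | "u = {n, a, c}" "S = R2" | "u = {n, a, b}" "S = R3"
      using X unfolding F'_def by blast
    then show "face (insert n V) s' u S"
    proof cases
      case 1
      obtain x y z where xyz: "u = {x, y, z}" "u \<subseteq> V" "x \<noteq> y" "x \<noteq> z" "y \<noteq> z"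
        "good (s x) (s y) (s z) S" "\<forall>v\<in>V - u. s v \<inter> S = {}"
        by (rule faceE[OF reg[OF insertI2[OF 1]]])
      have same: "s' v \<inter> S = s v \<inter> S" if "v \<in> V" for v
        using shrink[OF that] disjR[OF 1] by blast
      show ?thesis
      proof (rule faceI[OF xyz(1) _ xyz(3-5)])
        show "good (s' x) (s' y) (s' z) S"
          using xyz(1,2) by (intro good_cong[OF xyz(6)] same) auto
        show "s' v \<inter> S = {}" if "v \<in> insert n V" "v \<notin> u" for v
          using that same xyz(7) N(1) disjR[OF 1] by (cases "v = n") auto
      qed (use xyz(2) in blast)
    next
      case 2
      show ?thesis
      proof (rule faceI[OF 2(1)])
        show "s' v \<inter> S = {}" if "v \<in> insert n V" "v \<notin> u" for v
          using that other[OF _ Ri(1), of v] avoids(1) 2 t(1) by (cases "v = a") simp_all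
      qed (use 2 goods abc abcn abcV in simp_all)
    next
      case 3
      show ?thesis
      proof (rule faceI[OF 3(1)])
        show "s' v \<inter> S = {}" if "v \<in> insert n V" "v \<notin> u" for v
          using that other[OF _ Ri(2), of v] avoids(2) 3 t(1) by (cases "v = b") simp_all
      qed (use 3 goods abc abcn abcV in simp_all)
    next
      case 4
      show ?thesis
      proof (rule faceI[OF 4(1)])
        show "s' v \<inter> S = {}" if "v \<in> insert n V" "v \<notin> u" for v
          using that other[OF _ Ri(3), of v] avoids(3) 4 t(1) by (cases "v = c") simp_all
      qed (use 4 goods abc abcn abcV in simp_all)
    qed
  next
    fix X Y assume XY: "X \<in> F'" "Y \<in> F'" "X \<noteq> Y"
    let ?G = "{({n, b, c}, R1), ({n, a, c}, R2), ({n, a, b}, R3)}"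
    have GG: "snd X \<inter> snd Y = {}" if "X \<in> ?G" "Y \<in> ?G"
      using that XY(3) Ri(4-6) by auto
    have FG: "snd X \<inter> snd Y = {}" if "X \<in> F" "Y \<in> ?G" for X Y
    proof -
      have "snd Y \<subseteq> R" using that(2) Ri(1-3) by auto
      then show ?thesis using disjR[of "fst X" "snd X"] that(1) by auto
    qed
    show "snd X \<inter> snd Y = {}"
      using XY disj[OF insertI2 insertI2, of X Y] GG FG[of X Y] FG[of Y X] unfolding F'_def by blast
  qed
  have "{n, u, v} \<in> fst ` F'" if "u \<in> t" "v \<in> t" "u \<noteq> v" for u v
    using that t(1) unfolding F'_def by (auto simp: insert_commute)
  then have faces': "\<forall>u\<in>t. \<forall>v\<in>t. u \<noteq> v \<longrightarrow> {n, u, v} \<in> fst ` F'" by blast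
  have "F \<subseteq> F'" unfolding F'_def by (rule Un_upper1)
  then show thesis by (rule that[OF pack' _ faces'])
qed

lemma packing_triangle:
  assumes abc: "a \<noteq> b" "a \<noteq> c" "b \<noteq> c"
  obtains s R H where "packing {a, b, c} (\<noteq>) s {({a, b, c}, R), ({a, b, c}, H)}" "R \<noteq> H"
proof -
  \<comment> \<open>Chosen so that the comb parameters are 1 to 7 and 1 to 4. The horizontal arms of
    \<open>A\<close> and \<open>B\<close> run below \<open>R\<close>, the one of \<open>A\<close>
    meeting \<open>B\<close> at (6, 0). All horizontal arms lie below height 5, so \<open>H\<close>
    sees only the verticals at 0, 3 and 6.\<close>
  define C where "C = ell 0 3 8 10"
  define A where "A = ell 3 0 7 10"
  define B where "B = ell 6 (-1) 8 10"
  define R :: "(real \<times> real) set" where "R = {1..7} \<times> {1..2} \<union> ({1..2} \<union> {4..5}) \<times> {1..4}"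
  define H :: "(real \<times> real) set" where "H = UNIV \<times> {5..}"
  define s where "s = (\<lambda>v. if v = a then A else if v = b then B else C)"
  have s: "s a = A" "s b = B" "s c = C" using abc by (auto simp: s_def)
  have ell: "is_ell A" "is_ell B" "is_ell C"
    unfolding A_def B_def C_def by (simp_all add: is_ell_ell)
  have "(6, 0) \<in> A \<inter> B" "(3, 3) \<in> A \<inter> C" "(6, 3) \<in> B \<inter> C"
    by (auto simp: A_def B_def C_def ell_def)
  then have meet: "A \<inter> B \<noteq> {}" "A \<inter> C \<noteq> {}" "B \<inter> C \<noteq> {}" by blast+
  have "comb C A B R"
    by (rule combI[of 1 2 3 4 5 6 7 1 2 3 4]) (auto simp: R_def A_def B_def C_def ell_def)
  then have R: "good (s a) (s b) (s c) R"
    unfolding s by (rule good.swap23[OF good.swap12[OF good.comb]])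
  have "halfplane C A B H"
    unfolding halfplane_def
    by (rule exI[of _ 5], rule exI[of _ 0], rule exI[of _ 3], rule exI[of _ 6],
        rule exI[of _ 10], rule exI[of _ 10], rule exI[of _ 10])
      (auto simp: H_def A_def B_def C_def ell_def)
  then have H: "good (s a) (s b) (s c) H"
    unfolding s by (rule good.swap23[OF good.swap12[OF good.halfplane]])
  have RH: "R \<inter> H = {}" by (auto simp: R_def H_def)
  moreover have "(1, 1) \<in> R" by (simp add: R_def)
  ultimately have "R \<noteq> H" by blast
  moreover have "packing {a, b, c} (\<noteq>) s {({a, b, c}, R), ({a, b, c}, H)}"
    unfolding packing_def
  proof (intro conjI)
    have "face {a, b, c} s {a, b, c} R" "face {a, b, c} s {a, b, c} H"
      by (rule faceI[OF refl _ abc]; use R H in blast)+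
    then show "\<forall>t S. (t, S) \<in> {({a, b, c}, R), ({a, b, c}, H)} \<longrightarrow> face {a, b, c} s t S"
      by blast
  qed (use s ell meet RH in \<open>auto simp: Int_commute\<close>)
  ultimately show thesis using that by blast
qed

section \<open>Induction along the construction of the 3-tree\<close>

definition is_triangle :: "('a \<Rightarrow> 'a \<Rightarrow> bool) \<Rightarrow> 'a set \<Rightarrow> bool" where
  "is_triangle E t \<longleftrightarrow> (\<exists>a b c. t = {a, b, c} \<and> E a b \<and> E b c \<and> E a c)"

lemma three_tree_edge:
  "three_tree V E \<Longrightarrow> E u v \<Longrightarrow> u \<in> V \<and> v \<in> V \<and> u \<noteq> v \<and> E v u"
  by (induction arbitrary: u v rule: three_tree.induct) auto

text \<open>Common neighbours are counted instead of stackings: a triangle without a region already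
  has two, so stacking it would give three. The first conjunct supplies the neighbour other than
  \<open>n\<close> when a region is used up. The hypothesis passes to the smaller graph because
  triangles and adjacencies persist.\<close>

lemma three_tree_packing:
  assumes "three_tree V E"
    and "\<forall>t d e f. is_triangle E t \<longrightarrow> (\<forall>x\<in>t. E d x \<and> E e x \<and> E f x) \<longrightarrow> d = e \<or> d = f \<or> e = f"
  shows "\<exists>s F. packing V E s F \<and>
    (\<forall>t. is_triangle E t \<longrightarrow> (\<exists>d. \<forall>x\<in>t. E d x) \<and>
      (t \<in> fst ` F \<or> (\<exists>d e. d \<noteq> e \<and> (\<forall>x\<in>t. E d x \<and> E e x))))"
  using assms
proof induction
  case (K4 V)
  let ?E = "\<lambda>u v. u \<in> V \<and> v \<in> V \<and> u \<noteq> v"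
  from K4(1) obtain d V3 where V3: "V = insert d V3" "d \<notin> V3" "card V3 = 3"
    by (metis card_Suc_eq eval_nat_numeral(2) semiring_norm(26,27))
  from V3(3) obtain a b c where abc: "V3 = {a, b, c}" "a \<noteq> b" "a \<noteq> c" "b \<noteq> c"
    by (auto simp: card_3_iff)
  \<comment> \<open>The fourth vertex will consume \<open>R\<close>; \<open>H\<close> stays with
    \<open>{a, b, c}\<close>, so all four triangles own a region.\<close>
  obtain s R H where sRH: "packing {a, b, c} (\<noteq>) s (insert ({a, b, c}, R) {({a, b, c}, H)})" "R \<noteq> H"
    using packing_triangle[OF abc(2-4)] by metis
  obtain s' F' where F': "packing (insert d {a, b, c}) ?E s' F'" "{({a, b, c}, H)} \<subseteq> F'"
    "\<forall>u\<in>{a, b, c}. \<forall>v\<in>{a, b, c}. u \<noteq> v \<longrightarrow> {d, u, v} \<in> fst ` F'"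
  proof (rule packing_stack[OF sRH(1), of d ?E])
    show "({a, b, c}, R) \<notin> {({a, b, c}, H)}" using sRH(2) by simp
  qed (use V3 abc in auto)
  show ?case
  proof (rule exI[of _ s'], rule exI[of _ F'], intro conjI allI impI)
    show "packing V ?E s' F'" using F'(1) V3(1) abc(1) by simp
  next
    fix t assume "is_triangle ?E t"
    then obtain x y z where t: "t = {x, y, z}" "x \<in> V" "y \<in> V" "z \<in> V" "x \<noteq> y" "y \<noteq> z" "x \<noteq> z"
      unfolding is_triangle_def by blast
    then have "card t = 3" by simp
    then have "\<not> V \<subseteq> t" using card_mono[of t V] K4(1) t(1) by auto
    then obtain w where w: "w \<in> V" "w \<notin> t" by blast
    moreover have "t \<subseteq> V" using t by simp
    ultimately show "\<exists>d. \<forall>x\<in>t. d \<in> V \<and> x \<in> V \<and> d \<noteq> x" by blast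
    have "t \<in> fst ` F'"
    proof (cases "d \<in> t")
      case True
      then consider "x = d" | "y = d" | "z = d" using t(1) by blast
      then obtain u v where uv: "t = {d, u, v}" "u \<noteq> v" "u \<noteq> d" "v \<noteq> d" "u \<in> V" "v \<in> V"
      proof cases
        case 1 then show thesis using that[of y z] t by blast
      next
        case 2 then show thesis using that[of x z] t by blast
      next
        case 3 then show thesis using that[of x y] t by blast
      qed
      then have "u \<in> {a, b, c}" "v \<in> {a, b, c}" using V3(1) abc(1) by auto
      from F'(3)[THEN bspec, OF this(1), THEN bspec, OF this(2)] show ?thesis using uv(1,2) by blast
    next
      case False
      then have "t \<subseteq> V3" using t V3 by auto
      moreover have "finite V3" using abc(1) by simp
      ultimately have "t = V3" using card_subset_eq \<open>card t = 3\<close> V3(3) by metis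
      moreover have "({a, b, c}, H) \<in> F'" using F'(2) by blast
      ultimately show ?thesis using abc(1) imageI[of "({a, b, c}, H)" F' fst] by simp
    qed
    then show "t \<in> fst ` F' \<or> (\<exists>d e. d \<noteq> e \<and> (\<forall>x\<in>t. (d \<in> V \<and> x \<in> V \<and> d \<noteq> x) \<and> e \<in> V \<and> x \<in> V \<and> e \<noteq> x))" by blast
  qed
next
  case (add V E n a b c)
  let ?E = "\<lambda>u v. E u v \<or> (u = n \<and> v \<in> {a, b, c}) \<or> (v = n \<and> u \<in> {a, b, c})"
  let ?t = "{a, b, c}"
  have tri_mono: "is_triangle ?E t" if "is_triangle E t" for t
    using that unfolding is_triangle_def by blast
  have edge: "\<And>u v. E u v \<Longrightarrow> u \<in> V \<and> v \<in> V \<and> u \<noteq> v \<and> E v u"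
    using three_tree_edge[OF add(1)] by blast
  note few = add.prems[THEN spec, THEN spec, THEN spec, THEN spec, THEN mp, THEN mp]
  have "d = e \<or> d = f \<or> e = f" if "is_triangle E t" "\<forall>x\<in>t. E d x \<and> E e x \<and> E f x" for t d e f
    by (rule few[OF tri_mono[OF that(1)]]) (use that(2) in blast)
  then have "\<forall>t d e f. is_triangle E t \<longrightarrow> (\<forall>x\<in>t. E d x \<and> E e x \<and> E f x) \<longrightarrow> d = e \<or> d = f \<or> e = f"
    by blast
  from add.IH[OF this] obtain s F where sF: "packing V E s F"
    and IH: "\<forall>t. is_triangle E t \<longrightarrow> (\<exists>d. \<forall>x\<in>t. E d x) \<and>
      (t \<in> fst ` F \<or> (\<exists>d e. d \<noteq> e \<and> (\<forall>x\<in>t. E d x \<and> E e x)))"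
    by (elim exE conjE)
  have near: "\<exists>d. \<forall>x\<in>t. E d x"
    and avail: "t \<in> fst ` F \<or> (\<exists>d e. d \<noteq> e \<and> (\<forall>x\<in>t. E d x \<and> E e x))" if "is_triangle E t" for t
    using mp[OF spec[OF IH] that] by simp_all
  have tri: "is_triangle E ?t" unfolding is_triangle_def using add.hyps by blast
  have "?t \<in> fst ` F"
  proof (rule ccontr)
    assume "?t \<notin> fst ` F"
    then obtain d e where de: "d \<noteq> e" "\<forall>x\<in>?t. E d x \<and> E e x" using avail[OF tri] by blast
    then have "n \<noteq> d" "n \<noteq> e" using edge add.hyps(2) by blast+
    moreover have "\<forall>x\<in>?t. ?E d x \<and> ?E e x \<and> ?E n x" using de(2) by blast
    ultimately show False using few[OF tri_mono[OF tri], of d e n] de(1) by blast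
  qed
  then obtain R where R: "(?t, R) \<in> F" by auto
  define F0 where "F0 = F - {(?t, R)}"
  have F: "F = insert (?t, R) F0" "(?t, R) \<notin> F0" using R by (auto simp: F0_def)
  obtain s' F' where F': "packing (insert n V) ?E s' F'" "F0 \<subseteq> F'"
    "\<forall>u\<in>?t. \<forall>v\<in>?t. u \<noteq> v \<longrightarrow> {n, u, v} \<in> fst ` F'"
  proof (rule packing_stack[OF sF[unfolded F(1)] F(2) add.hyps(2), of ?E])
    show "?E u v \<longleftrightarrow> E u v" if "u \<in> V" "v \<in> V" for u v
      using that add.hyps(2) by blast
    show "(?E n u \<longleftrightarrow> u \<in> ?t) \<and> (?E u n \<longleftrightarrow> u \<in> ?t)" if "u \<in> V" for u
      using that add.hyps(2) edge by blast
  qed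
  show ?case
  proof (rule exI[of _ s'], rule exI[of _ F'], rule conjI[OF F'(1)], intro allI impI)
    fix t assume "is_triangle ?E t"
    then obtain x y z where t: "t = {x, y, z}" "?E x y" "?E y z" "?E x z"
      unfolding is_triangle_def by blast
    have n: "\<not> E n w" "\<not> E w n" "n \<notin> ?t" for w using edge add.hyps(2-5) by blast+
    show "(\<exists>d. \<forall>x\<in>t. ?E d x) \<and> (t \<in> fst ` F' \<or> (\<exists>d e. d \<noteq> e \<and> (\<forall>x\<in>t. ?E d x \<and> ?E e x)))"
    proof (cases "n \<in> t")
      case True
      then consider "x = n" | "y = n" | "z = n" using t(1) by blast
      then obtain u v where uv: "t = {n, u, v}" "u \<in> ?t" "v \<in> ?t" "E u v"
      proof cases
        case 1 then show thesis using that[of y z] t n by blast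
      next
        case 2 then show thesis using that[of x z] t n by blast
      next
        case 3 then show thesis using that[of x y] t n by blast
      qed
      note uv' = uv(2-4)
      then have "u \<noteq> v" using edge by blast
      \<comment> \<open>The remaining corner of the stacked triangle is the common neighbour of the
        new triangle.\<close>
      moreover obtain w where "w \<in> ?t" "w \<noteq> u" "w \<noteq> v"
      proof -
        have "a \<noteq> b" "b \<noteq> c" "a \<noteq> c" using edge add.hyps by blast+
        then show thesis using that uv' by auto
      qed
      moreover have "E p q" if "p \<in> ?t" "q \<in> ?t" "p \<noteq> q" for p q
        using that add.hyps edge by blast
      ultimately have "\<forall>x\<in>t. ?E w x" using uv(1) uv' by blast
      moreover have "t \<in> fst ` F'"
        using F'(3)[THEN bspec, OF uv'(1), THEN bspec, OF uv'(2)] \<open>u \<noteq> v\<close> uv(1) by simp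
      ultimately show ?thesis by (intro conjI disjI1 exI[of _ w])
    next
      case False
      then have "is_triangle E t" using t unfolding is_triangle_def by blast
      then obtain d where d: "\<forall>x\<in>t. E d x" using near by blast
      have "t \<in> fst ` F' \<or> (\<exists>d e. d \<noteq> e \<and> (\<forall>x\<in>t. ?E d x \<and> ?E e x))"
      proof (cases "t = ?t")
        case True
        \<comment> \<open>The stacked triangle has given up a region, but \<open>d\<close> and
          \<open>n\<close> are now two common neighbours.\<close>
        then have "\<forall>x\<in>t. ?E d x \<and> ?E n x" using d by blast
        moreover have "d \<noteq> n" using d n True by blast
        ultimately show ?thesis by blast
      next
        case False
        then have "t \<in> fst ` F \<Longrightarrow> t \<in> fst ` F'" using F(1) F'(2) by auto
        then show ?thesis using avail[OF \<open>is_triangle E t\<close>] by blast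
      qed
      moreover have "\<forall>x\<in>t. ?E d x" using d by blast
      ultimately show ?thesis by (intro conjI exI[of _ d])
    qed
  qed
qed

lemma packing_imp_L_graph:
  assumes "packing V E s F"
  shows "L_graph V E"
proof -
  have "\<exists>x y h w. h > 0 \<and> w > 0 \<and> s v = L_shape x y h w" if "v \<in> V" for v
  proof -
    have "is_ell (s v)" using assms that by (simp add: packing_def)
    then obtain x y r t where "x < r" "y < t" "s v = ell x y r t"
      unfolding is_ell_def by blast
    then have "t - y > 0 \<and> r - x > 0 \<and> s v = L_shape x y (t - y) (r - x)"
      by (simp add: L_shape_eq_ell)
    then show ?thesis by blast
  qed
  then obtain x y h w where L: "\<And>v. v \<in> V \<Longrightarrow> h v > 0 \<and> w v > 0 \<and> s v = L_shape (x v) (y v) (h v) (w v)"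
    by metis
  have adj: "E u v \<longleftrightarrow> s u \<inter> s v \<noteq> {}" if "u \<in> V" "v \<in> V" "u \<noteq> v" for u v
    using assms that by (simp add: packing_def)
  show ?thesis unfolding L_graph_def
  proof (rule exI[of _ x], rule exI[of _ y], rule exI[of _ h], rule exI[of _ w], intro conjI ballI impI)
    fix u v assume "u \<in> V" "v \<in> V" "u \<noteq> v"
    then show "E u v \<longleftrightarrow> L_shape (x u) (y u) (h u) (w u) \<inter> L_shape (x v) (y v) (h v) (w v) \<noteq> {}"
      using adj[of u v] L[of u] L[of v] by simp
  qed (use L in auto)
qed

theorem theorem2:
  fixes V :: "'a set" and E :: "'a \<Rightarrow> 'a \<Rightarrow> bool"
  assumes "three_tree V E" and "planar_graph V E"
  shows "L_graph V E"
proof -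
  have "d = e \<or> d = f \<or> e = f" if tri: "is_triangle E t" and nbs: "\<forall>x\<in>t. E d x \<and> E e x \<and> E f x" for t d e f
  proof (rule ccontr)
    assume distinct: "\<not> ?thesis"
    obtain a b c where t: "t = {a, b, c}" "E a b" "E b c" "E a c"
      using tri unfolding is_triangle_def by blast
    note edge = three_tree_edge[OF assms(1)]
    have joined: "E u v" if "u \<in> {a, b, c}" "v \<in> {d, e, f}" for u v
      using that nbs edge t(1) by blast
    have "a \<noteq> b" "a \<noteq> c" "b \<noteq> c" using t edge by blast+
    moreover have "{a, b, c, d, e, f} \<subseteq> V" using joined edge by blast
    \<comment> \<open>A vertex in both sets would be adjacent to itself.\<close>
    moreover have "{a, b, c} \<inter> {d, e, f} = {}" using joined edge by blast
    ultimately show False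
      using planar_graph_no_K33[OF assms(2), of a b c d e f] joined distinct by blast
  qed
  then have "\<forall>t d e f. is_triangle E t \<longrightarrow> (\<forall>x\<in>t. E d x \<and> E e x \<and> E f x) \<longrightarrow> d = e \<or> d = f \<or> e = f"
    by blast
  from three_tree_packing[OF assms(1) this] obtain s F where "packing V E s F"
    by (elim exE conjE)
  then show ?thesis by (rule packing_imp_L_graph)
qed

end
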